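(* Let $L$ be a finite semilattice and let $B\subseteq L^n$ be a $(\wedge,\vee)$-closed set. Then the number of $\vee$-irreducible elements of $B$ is at most $n\,|L^{\mathrm{ir}}|$, where $L^{\mathrm{ir}}$ is the set of $\vee$-irreducible elements of $L$.
   Context: Semilattices are meet-semilattices; the join $x\vee y$ (least common upper bound) may not exist. An element $l$ is $\vee$-irreducible if it is not the minimum and $l=a\vee b$ implies $l=a$ or $l=b$. $L^n$ carries the componentwise (product) order, so meets and, when they exist, joins are computed componentwise. A subset $B\subseteq L^n$ is $(\wedge,\vee)$-closed if both of the following hold: - $b_1\wedge b_2\in B$ for all $b_1,b_2\in B$; - $b_1\vee b_2\in B$ whenever $b_1,b_2\in B$ and $b_1\vee b_2$ exists in $L^n$. $B$ is regarded as a semilattice with the induced order. *)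

theory Defs
  imports "HOL-Library.Lub_Glb" "HOL-Library.FuncSet"
begin

text \<open>
  The power \<open>L\<^sup>n\<close> of a type \<open>L\<close> consists of the functions on \<open>{..<n}\<close> that are
  \<^const>\<open>undefined\<close> elsewhere. On these functions the pointwise order and meet of the
  function type are the componentwise order and meet of \<open>n\<close>-tuples, as the two lemmas show.
\<close>

definition tuples :: "nat \<Rightarrow> (nat \<Rightarrow> 'a) set" where
  "tuples n = {..<n} \<rightarrow>\<^sub>E UNIV"

lemma tuples_le_iff:
  fixes x y :: "nat \<Rightarrow> 'a::order"
  assumes "x \<in> tuples n" "y \<in> tuples n"
  shows "x \<le> y \<longleftrightarrow> (\<forall>i<n. x i \<le> y i)"
proof
  assume le: "\<forall>i<n. x i \<le> y i"
  show "x \<le> y"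
  proof (rule le_funI)
    fix i
    show "x i \<le> y i"
      using le assms by (cases "i < n") (auto simp: tuples_def PiE_iff extensional_def)
  qed
qed (simp add: le_fun_def)

lemma inf_in_tuples:
  fixes x y :: "nat \<Rightarrow> 'a::semilattice_inf"
  assumes "x \<in> tuples n" "y \<in> tuples n"
  shows "inf x y \<in> tuples n"
  using assms by (auto simp: tuples_def PiE_iff extensional_def)

text \<open>
  Below, \<open>isLub S {a, b} c\<close> says that \<open>c\<close> is the join of \<open>a\<close> and \<open>b\<close> in the poset \<open>S\<close> with the
  induced order: upper bounds are taken in \<open>S\<close> only. For a proper subset \<open>S\<close> this need not
  be the join in the surrounding type.
\<close>

definition join_irreducibles :: "'a::order set \<Rightarrow> 'a set" where
  "join_irreducibles S =
     {l \<in> S. \<not> (\<forall>x\<in>S. l \<le> x) \<and>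
             (\<forall>a\<in>S. \<forall>b\<in>S. isLub S {a, b} l \<longrightarrow> l = a \<or> l = b)}"

definition meet_join_closed :: "nat \<Rightarrow> (nat \<Rightarrow> 'a::semilattice_inf) set \<Rightarrow> bool" where
  "meet_join_closed n B \<longleftrightarrow>
     B \<subseteq> tuples n \<and>
     (\<forall>b1\<in>B. \<forall>b2\<in>B. inf b1 b2 \<in> B) \<and>
     (\<forall>b1\<in>B. \<forall>b2\<in>B. \<forall>c. isLub (tuples n) {b1, b2} c \<longrightarrow> c \<in> B)"

end

theory Submission
  imports Defs
begin

text \<open>
  A join-irreducible element \<open>b\<close> of \<open>B\<close> has a greatest element \<open>s\<close> of \<open>B\<close> strictly below it.
  Some coordinate has \<open>\<not> b i \<le> s i\<close>, so some join-irreducible \<open>l \<le> b i\<close> of \<open>L\<close> satisfies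
  \<open>\<not> l \<le> s i\<close>, and then \<open>b\<close> is the least \<open>x \<in> B\<close> with \<open>l \<le> x i\<close>. Hence the pair
  \<open>(i, l)\<close> determines \<open>b\<close>.
\<close>

lemma isLub_pair_iff:
  "isLub S {a, b} c \<longleftrightarrow> c \<in> S \<and> a \<le> c \<and> b \<le> c \<and> (\<forall>d\<in>S. a \<le> d \<longrightarrow> b \<le> d \<longrightarrow> c \<le> d)"
  by (auto simp: isLub_def isUb_def leastP_def setle_def setge_def)

lemma inf_less_left:
  fixes a b :: "'a::semilattice_inf"
  assumes "\<not> a \<le> b"
  shows "inf a b < a"
  using assms by (metis inf_le1 inf_le2 less_le)

text \<open>If \<open>m\<close> is minimal in \<open>A\<close> and \<open>x\<close> is in
  \<open>A\<close>, then \<open>inf m x\<close> is in \<open>A\<close> and below \<open>m\<close>,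
  so it equals \<open>m\<close>, whence \<open>m \<le> x\<close>.\<close>

lemma finite_inf_closed_has_least:
  fixes A :: "'a::semilattice_inf set"
  assumes "finite A" "A \<noteq> {}" and inf: "\<And>x y. x \<in> A \<Longrightarrow> y \<in> A \<Longrightarrow> inf x y \<in> A"
  obtains m where "m \<in> A" "\<And>x. x \<in> A \<Longrightarrow> m \<le> x"
proof -
  obtain m where m: "m \<in> A" "\<And>x. x \<in> A \<Longrightarrow> x \<le> m \<Longrightarrow> m = x"
    using finite_has_minimal[OF assms(1,2)] by blast
  have "m \<le> x" if "x \<in> A" for x
    using m(2)[OF inf[OF m(1) that]] inf_le1 inf_le2 by metis
  with m(1) show thesis using that by blast
qed

lemma finite_tuples: "finite (tuples n :: (nat \<Rightarrow> 'a::finite) set)"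
  by (auto simp: tuples_def intro: finite_PiE)

text \<open>The common upper bounds of \<open>x\<close> and \<open>y\<close> are finite in number
  and closed under meets. The bound \<open>b\<close> makes this set nonempty, so it has a least
  element, which is the join and lies below \<open>b\<close>.\<close>

lemma bounded_pair_has_isLub_tuples:
  fixes x y b :: "nat \<Rightarrow> 'a::{semilattice_inf,finite}"
  assumes "b \<in> tuples n" "x \<le> b" "y \<le> b"
  obtains c where "isLub (tuples n) {x, y} c" "c \<le> b"
proof -
  let ?U = "{d \<in> tuples n. x \<le> d \<and> y \<le> d}"
  have "finite ?U" by (rule finite_subset[OF _ finite_tuples[of n]]) auto
  moreover have "b \<in> ?U" using assms by auto
  moreover have "inf d e \<in> ?U" if "d \<in> ?U" "e \<in> ?U" for d e
    using that by (auto intro: inf_in_tuples)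
  ultimately obtain c where "c \<in> ?U" "\<And>d. d \<in> ?U \<Longrightarrow> c \<le> d"
    using finite_inf_closed_has_least[of ?U] by blast
  with \<open>b \<in> ?U\<close> show thesis by (intro that[of c]) (auto simp: isLub_pair_iff)
qed

text \<open>Take \<open>l\<close> minimal among the elements below \<open>a\<close> but not below
  \<open>c\<close>. If \<open>l\<close> were the join of two elements other than itself, minimality
  would put both below \<open>c\<close>, and hence \<open>l\<close> too.\<close>

lemma join_irreducible_separates:
  fixes a c :: "'a::{order,finite}"
  assumes "\<not> a \<le> c"
  obtains l where "l \<in> join_irreducibles UNIV" "l \<le> a" "\<not> l \<le> c"
proof -
  let ?A = "{x. x \<le> a \<and> \<not> x \<le> c}"
  have "?A \<noteq> {}" using assms by auto
  then obtain l where l: "l \<in> ?A" and min: "\<And>x. x \<in> ?A \<Longrightarrow> x \<le> l \<Longrightarrow> l = x"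
    using finite_has_minimal[of ?A] by auto
  have "l = u \<or> l = v" if "isLub UNIV {u, v} l" for u v
  proof (rule ccontr)
    assume "\<not> (l = u \<or> l = v)"
    moreover have "u \<le> l" "v \<le> l" using that by (auto simp: isLub_pair_iff)
    ultimately have "u \<le> c" "v \<le> c"
      using l min[of u] min[of v] by (auto intro: order_trans)
    with that l show False by (auto simp: isLub_pair_iff)
  qed
  \<comment> \<open>\<open>l\<close> is not a minimum of the type because it is not below
    \<open>c\<close>.\<close>
  with l have "l \<in> join_irreducibles UNIV" by (auto simp: join_irreducibles_def)
  with l show thesis using that by blast
qed

lemma meet_join_closedD:
  assumes "meet_join_closed n B"
  shows "B \<subseteq> tuples n"
    and "x \<in> B \<Longrightarrow> y \<in> B \<Longrightarrow> inf x y \<in> B"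
    and "x \<in> B \<Longrightarrow> y \<in> B \<Longrightarrow> isLub (tuples n) {x, y} c \<Longrightarrow> c \<in> B"
  using assms unfolding meet_join_closed_def by blast+

lemma join_irreduciblesD:
  assumes "l \<in> join_irreducibles S"
  shows "l \<in> S" and "\<exists>x\<in>S. \<not> l \<le> x"
    and "a \<in> S \<Longrightarrow> b \<in> S \<Longrightarrow> isLub S {a, b} l \<Longrightarrow> l = a \<or> l = b"
  using assms unfolding join_irreducibles_def by blast+

text \<open>A maximal \<open>s\<close> strictly below \<open>b\<close> is in fact greatest: for any
  other such \<open>y\<close>, the join of \<open>s\<close> and \<open>y\<close> exists because
  \<open>b\<close> bounds both, lies in \<open>B\<close> by closedness, and differs from
  \<open>b\<close> by irreducibility. Maximality makes this join equal to \<open>s\<close>.\<close>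

lemma join_irreducible_has_greatest_below:
  fixes B :: "(nat \<Rightarrow> 'a::{semilattice_inf,finite}) set"
  assumes B: "meet_join_closed n B" and b: "b \<in> join_irreducibles B"
  obtains s where "s \<in> B" "s < b" "\<And>x. x \<in> B \<Longrightarrow> x < b \<Longrightarrow> x \<le> s"
proof -
  let ?D = "{x \<in> B. x < b}"
  note sub = meet_join_closedD(1)[OF B] and bB = join_irreduciblesD(1)[OF b]
  \<comment> \<open>Since \<open>b\<close> is not the minimum of \<open>B\<close>, some meet with
    \<open>b\<close> lies strictly below \<open>b\<close>, so \<open>?D\<close> is nonempty.\<close>
  obtain x where "x \<in> B" "\<not> b \<le> x" using join_irreduciblesD(2)[OF b] by blast
  then have "inf b x \<in> ?D"
    using bB by (simp add: meet_join_closedD(2)[OF B] inf_less_left)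
  moreover have "finite ?D" using finite_subset[OF sub finite_tuples] by simp
  ultimately obtain s where s: "s \<in> ?D" and max: "\<And>x. x \<in> ?D \<Longrightarrow> s \<le> x \<Longrightarrow> s = x"
    using finite_has_maximal[of ?D] by blast
  have "y \<le> s" if y: "y \<in> B" "y < b" for y
  proof -
    obtain c where c: "isLub (tuples n) {s, y} c" "c \<le> b"
    proof (rule bounded_pair_has_isLub_tuples)
      show "b \<in> tuples n" using sub bB by blast
      show "s \<le> b" "y \<le> b" using s y by (auto intro: less_imp_le)
    qed
    have "c \<in> B" using meet_join_closedD(3)[OF B] s y(1) c(1) by blast
    \<comment> \<open>A join taken in \<open>tuples n\<close> that lies in \<open>B\<close> is also
      the join in \<open>B\<close>, where there are only fewer upper bounds to compare with.\<close>
    then have "isLub B {s, y} c" using c sub unfolding isLub_pair_iff by blast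
    then have "c \<noteq> b" using join_irreduciblesD(3)[OF b, of s y] s y by auto
    moreover have "s \<le> c" "y \<le> c" using c by (auto simp: isLub_pair_iff)
    ultimately show ?thesis using max[of c] c(2) \<open>c \<in> B\<close> by simp
  qed
  with s show thesis using that by blast
qed

lemma join_irreducible_is_least:
  fixes B :: "(nat \<Rightarrow> 'a::{semilattice_inf,finite}) set"
  assumes B: "meet_join_closed n B" and b: "b \<in> join_irreducibles B"
  obtains i l where "i < n" "l \<in> join_irreducibles UNIV" "l \<le> b i"
    "\<And>x. x \<in> B \<Longrightarrow> l \<le> x i \<Longrightarrow> b \<le> x"
proof -
  obtain s where s: "s \<in> B" "s < b" "\<And>x. x \<in> B \<Longrightarrow> x < b \<Longrightarrow> x \<le> s"
    using join_irreducible_has_greatest_below[OF B b] by blast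
  note bB = join_irreduciblesD(1)[OF b]
  have "b \<in> tuples n" "s \<in> tuples n"
    using meet_join_closedD(1)[OF B] bB s(1) by auto
  then obtain i where i: "i < n" "\<not> b i \<le> s i"
    using s(2) tuples_le_iff[of b n s] by (auto simp: less_le_not_le)
  then obtain l where l: "l \<in> join_irreducibles UNIV" "l \<le> b i" "\<not> l \<le> s i"
    using join_irreducible_separates by blast
  \<comment> \<open>Otherwise \<open>inf b x\<close> is an element of \<open>B\<close> strictly
    below \<open>b\<close>, hence below \<open>s\<close>. As \<open>l\<close> lies below both
    \<open>b i\<close> and \<open>x i\<close>, this would give \<open>l \<le> s i\<close>.\<close>
  have "b \<le> x" if "x \<in> B" "l \<le> x i" for x
  proof (rule ccontr)
    assume "\<not> b \<le> x"
    then have "inf b x < b" by (rule inf_less_left)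
    moreover have "inf b x \<in> B" using bB that(1) by (rule meet_join_closedD(2)[OF B])
    ultimately have "inf b x \<le> s" by (simp only: s(3))
    then have "inf b x i \<le> s i" by (rule le_funD)
    moreover have "l \<le> inf b x i" using l that by simp
    ultimately show False using l(3) order_trans by blast
  qed
  with i l show thesis using that by blast
qed

theorem theorem3p1:
  fixes n :: nat
    and B :: "(nat \<Rightarrow> 'a::{semilattice_inf,finite}) set"
  assumes "meet_join_closed n B"
  shows "card (join_irreducibles B) \<le> n * card (join_irreducibles (UNIV :: 'a set))"
proof -
  let ?J = "join_irreducibles (UNIV :: 'a set)"
  have "\<exists>p. p \<in> {..<n} \<times> ?J \<and> snd p \<le> b (fst p) \<and> (\<forall>x\<in>B. snd p \<le> x (fst p) \<longrightarrow> b \<le> x)"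
    if b: "b \<in> join_irreducibles B" for b
  proof -
    obtain i l where "i < n" "l \<in> ?J" "l \<le> b i" "\<And>x. x \<in> B \<Longrightarrow> l \<le> x i \<Longrightarrow> b \<le> x"
      using join_irreducible_is_least[OF assms b] by blast
    then show ?thesis by (intro exI[of _ "(i, l)"]) auto
  qed
  then obtain f where f: "\<And>b. b \<in> join_irreducibles B \<Longrightarrow> f b \<in> {..<n} \<times> ?J"
      "\<And>b. b \<in> join_irreducibles B \<Longrightarrow> snd (f b) \<le> b (fst (f b))"
      "\<And>b x. b \<in> join_irreducibles B \<Longrightarrow> x \<in> B \<Longrightarrow> snd (f b) \<le> x (fst (f b)) \<Longrightarrow> b \<le> x"
    by metis
  have BJ: "join_irreducibles B \<subseteq> B" by (auto simp: join_irreducibles_def)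
  have "inj_on f (join_irreducibles B)"
  proof (rule inj_onI)
    fix b c assume bc: "b \<in> join_irreducibles B" "c \<in> join_irreducibles B" "f b = f c"
    show "b = c"
    \<comment> \<open>With a common pair \<open>(i, l)\<close>, both \<open>b\<close> and
      \<open>c\<close> are in \<open>B\<close> and have \<open>l\<close> below their coordinate
      \<open>i\<close>, so the leastness of each puts it below the other.\<close>
    proof (rule antisym)
      show "b \<le> c" using f(3)[of b c] f(2)[of c] bc BJ by auto
      show "c \<le> b" using f(3)[of c b] f(2)[of b] bc BJ by auto
    qed
  qed
  moreover have "f ` join_irreducibles B \<subseteq> {..<n} \<times> ?J" using f(1) by blast
  ultimately have "card (join_irreducibles B) \<le> card ({..<n} \<times> ?J)"
    by (intro card_inj_on_le) auto
  then show ?thesis by (simp add: card_cartesian_product)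
qed

end
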